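(* Let $J=3$, let $0<d_i<\rho<u_i$ for $i=1,2,3$, and let $f:\mathbb{R}^3_+\to\mathbb{R}_+$ be continuous, convex and sub-modular. Let $$\alpha_{123}=1-\frac{u_1-\rho}{u_1-d_1}-\frac{u_2-\rho}{u_2-d_2}-\frac{u_3-\rho}{u_3-d_3},$$ and for $z=(z^1,z^2,z^3)$ with positive coordinates let $$(\mathcal{B}f)(z)=\min_{\gamma\in\mathbb{R}^3}\max_{\{\xi:\ \xi^j\in[d_j,u_j]\}}\,[f(\xi\circ z)-(\gamma,\xi\circ z-\rho z)].$$ (i) If $\alpha_{123}\ge0$, then $$(\mathcal{B}f)(z)=\alpha_{123}f_{\emptyset}(z)+\frac{u_1-\rho}{u_1-d_1}f_{\{1\}}(z)+\frac{u_2-\rho}{u_2-d_2}f_{\{2\}}(z)+\frac{u_3-\rho}{u_3-d_3}f_{\{3\}}(z).$$ (ii) If $\alpha_{123}\le-1$, then $$(\mathcal{B}f)(z)=-(\alpha_{123}+1)f_{\{1,2,3\}}(z)+\frac{\rho-d_1}{u_1-d_1}f_{\{2,3\}}(z)+\frac{\rho-d_2}{u_2-d_2}f_{\{1,3\}}(z)+\frac{\rho-d_3}{u_3-d_3}f_{\{1,2\}}(z).$$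
   Context: $(\cdot,\cdot)$ is the Euclidean inner product and $\circ$ is coordinatewise multiplication, $(y\circ z)^i=y^iz^i$. For $I\subset\{1,2,3\}$, $f_I(z)=f(\xi^1z^1,\xi^2z^2,\xi^3z^3)$ with $\xi^i=d_i$ for $i\in I$ and $\xi^i=u_i$ for $i\notin I$. A function $h:\mathbb{R}^2_+\to\mathbb{R}_+$ is sub-modular if $h(x_1,y_2)+h(y_1,x_2)\ge h(x_1,x_2)+h(y_1,y_2)$ whenever $x_1\le y_1$ and $x_2\le y_2$; a function of several variables is sub-modular if it is sub-modular with respect to any two of its variables (the others being fixed). *)

theory Defs
  imports "HOL-Analysis.Analysis"
begin

text \<open>Coordinatewise multiplication of vectors is the library product \<open>*\<close> on \<^typ>\<open>real ^ 3\<close>.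
  Throughout, \<open>R\<^sub>+\<close> is the closed half-line of nonnegative reals. Functions on the orthant
  are total functions on \<^typ>\<open>real ^ 3\<close> of which only the values on \<open>orthant\<close> matter.\<close>

definition orthant :: "(real ^ 3) set" where
  "orthant = {x. \<forall>i. 0 \<le> x $ i}"

definition submodular2 :: "(real \<Rightarrow> real \<Rightarrow> real) \<Rightarrow> bool" where
  "submodular2 h \<longleftrightarrow>
     (\<forall>x1 x2 y1 y2. 0 \<le> x1 \<and> x1 \<le> y1 \<and> 0 \<le> x2 \<and> x2 \<le> y2 \<longrightarrow>
        h x1 y2 + h y1 x2 \<ge> h x1 x2 + h y1 y2)"

definition submodular :: "(real ^ 3 \<Rightarrow> real) \<Rightarrow> bool" where
  "submodular f \<longleftrightarrow>
     (\<forall>i j. \<forall>w\<in>orthant. i \<noteq> j \<longrightarrow>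
        submodular2 (\<lambda>s t. f (\<chi> k. if k = i then s else if k = j then t else w $ k)))"

definition vertex_value ::
    "real ^ 3 \<Rightarrow> real ^ 3 \<Rightarrow> (real ^ 3 \<Rightarrow> real) \<Rightarrow> 3 set \<Rightarrow> real ^ 3 \<Rightarrow> real" where
  "vertex_value d u f I z = f ((\<chi> i. if i \<in> I then d $ i else u $ i) * z)"

definition payoff ::
    "real \<Rightarrow> (real ^ 3 \<Rightarrow> real) \<Rightarrow> real ^ 3 \<Rightarrow> real ^ 3 \<Rightarrow> real ^ 3 \<Rightarrow> real" where
  "payoff \<rho> f z \<gamma> \<xi> = f (\<xi> * z) - \<gamma> \<bullet> (\<xi> * z - \<rho> *\<^sub>R z)"

definition worst_case ::
    "real ^ 3 \<Rightarrow> real ^ 3 \<Rightarrow> real \<Rightarrow> (real ^ 3 \<Rightarrow> real) \<Rightarrow> real ^ 3 \<Rightarrow> real ^ 3 \<Rightarrow> real" where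
  "worst_case d u \<rho> f z \<gamma> = (SUP \<xi>\<in>cbox d u. payoff \<rho> f z \<gamma> \<xi>)"

text \<open>The max and the min are written as a real supremum and infimum, which are meaningful only
  for bounded sets; that both are attained has to be asserted where the operator is used.\<close>

definition bellman ::
    "real ^ 3 \<Rightarrow> real ^ 3 \<Rightarrow> real \<Rightarrow> (real ^ 3 \<Rightarrow> real) \<Rightarrow> real ^ 3 \<Rightarrow> real" where
  "bellman d u \<rho> f z = (INF \<gamma>. worst_case d u \<rho> f z \<gamma>)"

definition alpha123 :: "real ^ 3 \<Rightarrow> real ^ 3 \<Rightarrow> real \<Rightarrow> real" where
  "alpha123 d u \<rho> =
     1 - (u $ 1 - \<rho>) / (u $ 1 - d $ 1) - (u $ 2 - \<rho>) / (u $ 2 - d $ 2)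
       - (u $ 3 - \<rho>) / (u $ 3 - d $ 3)"

end

theory Submission
  imports Defs
begin

text \<open>
  The value of the game is found by interpolating \<open>f\<close> at four of the eight vertices of the box: a
  base vertex and its three neighbours. Let \<open>q\<close> be the base and \<open>p\<close> the opposite vertex, so that
  \<open>(p, q)\<close> is \<open>(d, u)\<close> in the first case and \<open>(u, d)\<close> in the second. There is exactly one way to
  write the point \<open>(\<rho>, \<rho>, \<rho>)\<close> as an affine combination of these four vertices: the neighbour in
  direction \<open>i\<close> gets the weight \<open>(q\<^sub>i - \<rho>) / (q\<^sub>i - p\<^sub>i)\<close> and the base gets the rest. The condition on
  \<open>\<alpha>\<^sub>1\<^sub>2\<^sub>3\<close> says precisely that the weight of the base is nonnegative, hence that the weights form a
  probability distribution with mean \<open>\<rho>\<close> in every coordinate.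

  Under such a distribution the linear term of the payoff averages to zero whatever \<open>\<gamma>\<close> is, and a
  maximum is at least an average. So no hedge does better than the average of \<open>f\<close> over the
  four vertices. Conversely, let \<open>\<gamma>\<close> be the slope of the affine function that agrees with \<open>f\<close> at the
  four vertices. Submodularity makes the increments of \<open>f\<close> away from the base at most additive
  (lemma \<open>vertex_value_le_marginals\<close>), so this affine function dominates \<open>f\<close> at all eight
  vertices; by convexity it dominates \<open>f\<close> on the box (lemma \<open>convex_on_cbox_vertex_bound\<close>).
  Hence the payoff of this \<open>\<gamma>\<close> never exceeds the value of the affine function at \<open>(\<rho>, \<rho>, \<rho>)\<close>,
  which is the same average (lemma \<open>bellman_eq_interpolation\<close>). Submodularity is invariant under
  reversing all coordinates at once, which is why one argument covers both cases.

  The minimum over \<open>\<gamma>\<close> is attained for every \<open>\<alpha>\<^sub>1\<^sub>2\<^sub>3\<close>: the worst case is a Lipschitz function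
  of \<open>\<gamma>\<close>, and it is coercive because \<open>\<rho>\<close> lies strictly between \<open>d\<^sub>i\<close> and \<open>u\<^sub>i\<close> and \<open>f\<close> is nonnegative.
\<close>

section \<open>Convex functions on a box\<close>

text \<open>
  A coordinate of \<open>x\<close> strictly between its bounds can be pushed to either of them, and \<open>x\<close> is a convex
  combination of the two results. Induction on the number of such coordinates ends at the vertices.
\<close>

lemma convex_on_cbox_vertex_bound:
  fixes g :: "real ^ 'n \<Rightarrow> real"
  assumes conv: "convex_on (cbox d u) g"
    and vert: "\<And>x. (\<And>i. x $ i = d $ i \<or> x $ i = u $ i) \<Longrightarrow> g x \<le> c"
    and less: "\<And>i. d $ i < u $ i"
    and x: "x \<in> cbox d u"
  shows "g x \<le> c"
  using x
proof (induction "card {i. x $ i \<noteq> d $ i \<and> x $ i \<noteq> u $ i}" arbitrary: x rule: less_induct)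
  case less': less
  show ?case
  proof (cases "\<exists>i. x $ i \<noteq> d $ i \<and> x $ i \<noteq> u $ i")
    case False
    then show ?thesis using vert by blast
  next
    case True
    then obtain i where i: "x $ i \<noteq> d $ i" "x $ i \<noteq> u $ i" by blast
    define put where "put s = (\<chi> k. if k = i then s else x $ k)" for s
    have step: "g (put s) \<le> c" if s: "s = d $ i \<or> s = u $ i" for s
    proof (rule less'.hyps)
      have "{k. put s $ k \<noteq> d $ k \<and> put s $ k \<noteq> u $ k} \<subset> {k. x $ k \<noteq> d $ k \<and> x $ k \<noteq> u $ k}"
        using i s by (auto simp: put_def psubset_eq split: if_splits)
      then show "card {k. put s $ k \<noteq> d $ k \<and> put s $ k \<noteq> u $ k}
          < card {k. x $ k \<noteq> d $ k \<and> x $ k \<noteq> u $ k}"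
        by (intro psubset_card_mono) auto
      show "put s \<in> cbox d u"
        using less'.prems s less[of i] by (auto simp: put_def mem_box_cart)
    qed
    define t where "t = (x $ i - d $ i) / (u $ i - d $ i)"
    have t: "0 \<le> t" "t \<le> 1"
      using less'.prems less[of i] by (auto simp: t_def mem_box_cart)
    have ti: "t * (u $ i - d $ i) = x $ i - d $ i"
      using less[of i] by (simp add: t_def)
    have comb: "x = (1 - t) *\<^sub>R put (d $ i) + t *\<^sub>R put (u $ i)"
      using ti by (auto simp: vec_eq_iff put_def algebra_simps)
    have "put (d $ i) \<in> cbox d u" "put (u $ i) \<in> cbox d u"
      using less'.prems less[of i] by (auto simp: put_def mem_box_cart)
    then have "g x \<le> (1 - t) * g (put (d $ i)) + t * g (put (u $ i))"
      using convex_onD[OF conv t] comb by metis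
    also have "\<dots> \<le> (1 - t) * c + t * c"
      using t step by (intro add_mono mult_left_mono) auto
    finally show ?thesis by (simp add: algebra_simps)
  qed
qed

section \<open>Submodularity at the vertices of a box\<close>

lemma vertex_value_swap: "vertex_value d u f I z = vertex_value u d f (- I) z"
  unfolding vertex_value_def by (rule arg_cong[of _ _ "\<lambda>v. f (v * z)"]) (simp add: vec_eq_iff)

text \<open>
  On the vertices of a box, submodularity becomes submodularity of a set function. The bounds may
  come in either order, as long as it is the same in all coordinates: reversing two coordinates
  leaves the submodular inequality unchanged, whereas reversing a single one would turn it around.
\<close>

lemma vertex_value_insert2:
  assumes f: "submodular f" and z: "\<And>k. 0 \<le> z $ k"
    and nonneg: "\<And>k. 0 \<le> p $ k" "\<And>k. 0 \<le> q $ k"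
    and ord: "(\<forall>k. p $ k \<le> q $ k) \<or> (\<forall>k. q $ k \<le> p $ k)"
    and ij: "i \<noteq> j" "i \<notin> I" "j \<notin> I"
  shows "vertex_value p q f (insert i (insert j I)) z + vertex_value p q f I z
       \<le> vertex_value p q f (insert i I) z + vertex_value p q f (insert j I) z"
proof -
  define w where "w = (\<chi> k. if k \<in> I then p $ k else q $ k) * z"
  define h where "h s t = f (\<chi> k. if k = i then s else if k = j then t else w $ k)" for s t
  have "w \<in> orthant" using z nonneg by (simp add: w_def orthant_def)
  then have sub: "h x1 x2 + h y1 y2 \<le> h x1 y2 + h y1 x2"
    if "0 \<le> x1" "x1 \<le> y1" "0 \<le> x2" "x2 \<le> y2" for x1 x2 y1 y2
    using f ij that unfolding submodular_def submodular2_def h_def by blast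
  have val: "vertex_value p q f (insert i (insert j I)) z = h (p $ i * z $ i) (p $ j * z $ j)"
    "vertex_value p q f I z = h (q $ i * z $ i) (q $ j * z $ j)"
    "vertex_value p q f (insert i I) z = h (p $ i * z $ i) (q $ j * z $ j)"
    "vertex_value p q f (insert j I) z = h (q $ i * z $ i) (p $ j * z $ j)"
    using ij unfolding vertex_value_def h_def w_def
    by (auto intro!: arg_cong[of _ _ f] simp: vec_eq_iff)
  show ?thesis
    using ord
  proof
    assume "\<forall>k. p $ k \<le> q $ k"
    then show ?thesis
      unfolding val using sub[of "p $ i * z $ i" "q $ i * z $ i" "p $ j * z $ j" "q $ j * z $ j"]
      by (simp add: z nonneg mult_right_mono)
  next
    assume "\<forall>k. q $ k \<le> p $ k"
    then show ?thesis
      unfolding val using sub[of "q $ i * z $ i" "p $ i * z $ i" "q $ j * z $ j" "p $ j * z $ j"]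
      by (simp add: z nonneg mult_right_mono)
  qed
qed

text \<open>
  Enlarging \<open>J\<close> decreases the gain from adding \<open>i\<close> to it, so this gain is largest at \<open>J = {}\<close>.
  Adding the elements of \<open>I\<close> one by one then gives the bound.
\<close>

lemma vertex_value_le_marginals:
  assumes f: "submodular f" and z: "\<And>k. 0 \<le> z $ k"
    and nonneg: "\<And>k. 0 \<le> p $ k" "\<And>k. 0 \<le> q $ k"
    and ord: "(\<forall>k. p $ k \<le> q $ k) \<or> (\<forall>k. q $ k \<le> p $ k)"
  shows "vertex_value p q f I z
    \<le> vertex_value p q f {} z + (\<Sum>i\<in>I. vertex_value p q f {i} z - vertex_value p q f {} z)"
proof -
  define F where "F I = vertex_value p q f I z" for I
  note insert2 = vertex_value_insert2[OF f z nonneg ord, folded F_def]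
  have marginal: "F (insert i J) - F J \<le> F {i} - F {}" if "i \<notin> J" for i J
    using finite[of J] that
  proof (induction J rule: finite_induct)
    case (insert j J)
    then show ?case using insert2[of i j J] by auto
  qed simp
  have "F I \<le> F {} + (\<Sum>i\<in>I. F {i} - F {})"
    using finite[of I]
  proof (induction I rule: finite_induct)
    case (insert i I)
    then show ?case using marginal[of i I] by simp
  qed simp
  then show ?thesis by (simp add: F_def)
qed

section \<open>The worst case as a function of the hedge\<close>

text \<open>
  The player chooses \<open>\<gamma>\<close>, nature answers with \<open>\<xi>\<close> in the box.
\<close>

locale robust_hedging =
  fixes d u z :: "real ^ 3" and \<rho> :: real and f :: "real ^ 3 \<Rightarrow> real"
  assumes d_pos: "\<And>i. 0 < d $ i" and d_less: "\<And>i. d $ i < \<rho>" and less_u: "\<And>i. \<rho> < u $ i"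
    and f_nonneg: "\<And>x. x \<in> orthant \<Longrightarrow> 0 \<le> f x"
    and f_cont: "continuous_on orthant f"
    and f_convex: "convex_on orthant f"
    and f_submodular: "submodular f"
    and z_pos: "\<And>i. 0 < z $ i"
begin

lemma d_less_u: "d $ i < u $ i"
  using d_less[of i] less_u[of i] by simp

lemma cbox_nonempty: "cbox d u \<noteq> {}"
  using d_less_u by (auto simp: interval_ne_empty_cart intro: less_imp_le)

lemma prices_in_orthant: "\<xi> * z \<in> orthant" if "\<xi> \<in> cbox d u"
proof -
  have "0 \<le> \<xi> $ i" for i
    using that d_pos[of i] by (auto simp: mem_box_cart intro: order_trans[OF less_imp_le])
  then show ?thesis using z_pos by (simp add: orthant_def less_imp_le)
qed

lemma continuous_on_prices: "continuous_on S (\<lambda>\<xi>. \<xi> * z)"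
  unfolding times_vec_def by (intro continuous_intros)

lemma continuous_on_payoff: "continuous_on (cbox d u) (payoff \<rho> f z \<gamma>)"
  unfolding payoff_def
  by (intro continuous_intros continuous_on_prices continuous_on_compose2[OF f_cont])
    (use prices_in_orthant in auto)

lemma payoff_attains_max:
  "\<exists>\<xi>\<in>cbox d u. \<forall>\<xi>'\<in>cbox d u. payoff \<rho> f z \<gamma> \<xi>' \<le> payoff \<rho> f z \<gamma> \<xi>"
  by (rule continuous_attains_sup[OF compact_cbox cbox_nonempty continuous_on_payoff])

lemma payoff_le_worst_case:
  "\<xi> \<in> cbox d u \<Longrightarrow> payoff \<rho> f z \<gamma> \<xi> \<le> worst_case d u \<rho> f z \<gamma>"
  unfolding worst_case_def
  by (intro cSUP_upper bounded_imp_bdd_above compact_imp_bounded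
      compact_continuous_image[OF continuous_on_payoff compact_cbox])

lemma worst_case_le:
  "(\<And>\<xi>. \<xi> \<in> cbox d u \<Longrightarrow> payoff \<rho> f z \<gamma> \<xi> \<le> c) \<Longrightarrow> worst_case d u \<rho> f z \<gamma> \<le> c"
  unfolding worst_case_def by (intro cSUP_least cbox_nonempty)

text \<open>
  The payoff is affine in \<open>\<gamma>\<close>, with a slope that is bounded over the box; so the
  supremum is Lipschitz with that bound as its constant.
\<close>

lemma continuous_on_worst_case: "continuous_on S (worst_case d u \<rho> f z)"
proof -
  have "bounded ((\<lambda>\<xi>. \<xi> * z - \<rho> *\<^sub>R z) ` cbox d u)"
    by (intro compact_imp_bounded compact_continuous_image continuous_intros continuous_on_prices
        compact_cbox)
  then obtain K where K: "0 < K" "\<And>\<xi>. \<xi> \<in> cbox d u \<Longrightarrow> norm (\<xi> * z - \<rho> *\<^sub>R z) \<le> K"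
    unfolding bounded_pos by auto
  have le: "worst_case d u \<rho> f z \<gamma> \<le> worst_case d u \<rho> f z \<gamma>' + K * norm (\<gamma> - \<gamma>')" for \<gamma> \<gamma>'
  proof (rule worst_case_le)
    fix \<xi> assume \<xi>: "\<xi> \<in> cbox d u"
    have "payoff \<rho> f z \<gamma> \<xi> = payoff \<rho> f z \<gamma>' \<xi> - (\<gamma> - \<gamma>') \<bullet> (\<xi> * z - \<rho> *\<^sub>R z)"
      by (simp add: payoff_def inner_diff_left)
    moreover have "- ((\<gamma> - \<gamma>') \<bullet> (\<xi> * z - \<rho> *\<^sub>R z)) \<le> norm (\<gamma> - \<gamma>') * norm (\<xi> * z - \<rho> *\<^sub>R z)"
      using Cauchy_Schwarz_ineq2[of "\<gamma> - \<gamma>'" "\<xi> * z - \<rho> *\<^sub>R z"] by linarith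
    moreover have "\<dots> \<le> norm (\<gamma> - \<gamma>') * K"
      using K(2)[OF \<xi>] by (intro mult_left_mono) auto
    ultimately show "payoff \<rho> f z \<gamma> \<xi> \<le> worst_case d u \<rho> f z \<gamma>' + K * norm (\<gamma> - \<gamma>')"
      using payoff_le_worst_case[OF \<xi>, of \<gamma>'] by (simp add: mult.commute)
  qed
  have "K-lipschitz_on S (worst_case d u \<rho> f z)"
  proof (rule lipschitz_onI)
    fix \<gamma> \<gamma>'
    show "dist (worst_case d u \<rho> f z \<gamma>) (worst_case d u \<rho> f z \<gamma>') \<le> K * dist \<gamma> \<gamma>'"
      using le[of \<gamma> \<gamma>'] le[of \<gamma>' \<gamma>] by (simp add: dist_norm norm_minus_commute abs_le_iff)
  qed (use K in simp)
  then show ?thesis by (rule lipschitz_on_continuous_on)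
qed

lemma worst_case_coercive:
  obtains c where "0 < c" "\<And>\<gamma>. c * norm \<gamma> \<le> worst_case d u \<rho> f z \<gamma>"
proof
  define c where "c = Min (range (\<lambda>i. z $ i * min (\<rho> - d $ i) (u $ i - \<rho>)))"
  show "0 < c"
    unfolding c_def using z_pos d_less less_u by (subst Min_gr_iff) auto
  have c: "c \<le> z $ i * min (\<rho> - d $ i) (u $ i - \<rho>)" for i
    unfolding c_def by (intro Min_le) auto
  fix \<gamma> :: "real ^ 3"
  \<comment> \<open>nature moves every price in the direction in which the hedge loses; this gains at least
    \<open>c\<close> per unit of each \<open>\<bar>\<gamma> $ i\<bar>\<close> because \<open>\<rho>\<close> is strictly inside every interval\<close>
  define \<xi> :: "real ^ 3" where "\<xi> = (\<chi> i. if 0 \<le> \<gamma> $ i then d $ i else u $ i)"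
  have \<xi>: "\<xi> \<in> cbox d u"
    using d_less_u by (auto simp: \<xi>_def mem_box_cart intro: less_imp_le)
  have summand: "c * \<bar>\<gamma> $ i\<bar> \<le> - (\<gamma> $ i * (\<xi> $ i * z $ i - \<rho> * z $ i))" for i
  proof -
    have "c \<le> z $ i * (\<rho> - d $ i)" "c \<le> z $ i * (u $ i - \<rho>)"
      using c[of i] z_pos[of i] by (meson min.cobounded1 min.cobounded2 mult_left_mono order_trans less_imp_le)+
    then have "c * \<bar>\<gamma> $ i\<bar> \<le> (z $ i * \<bar>\<rho> - \<xi> $ i\<bar>) * \<bar>\<gamma> $ i\<bar>"
      using d_less[of i] less_u[of i] by (intro mult_right_mono) (auto simp: \<xi>_def)
    also have "\<dots> = - (\<gamma> $ i * (\<xi> $ i * z $ i - \<rho> * z $ i))"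
      using d_less[of i] less_u[of i] by (auto simp: \<xi>_def algebra_simps)
    finally show ?thesis .
  qed
  have "c * norm \<gamma> \<le> c * (\<Sum>i\<in>UNIV. \<bar>\<gamma> $ i\<bar>)"
    using \<open>0 < c\<close> norm_le_l1_cart[of \<gamma>] by simp
  also have "\<dots> \<le> (\<Sum>i\<in>UNIV. - (\<gamma> $ i * (\<xi> $ i * z $ i - \<rho> * z $ i)))"
    unfolding sum_distrib_left by (intro sum_mono summand)
  also have "\<dots> = - (\<gamma> \<bullet> (\<xi> * z - \<rho> *\<^sub>R z))"
    by (simp add: inner_vec_def sum_negf)
  also have "\<dots> \<le> payoff \<rho> f z \<gamma> \<xi>"
    using f_nonneg[OF prices_in_orthant[OF \<xi>]] by (simp add: payoff_def)
  also have "\<dots> \<le> worst_case d u \<rho> f z \<gamma>"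
    by (rule payoff_le_worst_case[OF \<xi>])
  finally show "c * norm \<gamma> \<le> worst_case d u \<rho> f z \<gamma>" .
qed

lemma worst_case_attains_min: "\<exists>\<gamma>. \<forall>\<gamma>'. worst_case d u \<rho> f z \<gamma> \<le> worst_case d u \<rho> f z \<gamma>'"
proof -
  let ?W = "worst_case d u \<rho> f z"
  obtain c where c: "0 < c" "\<And>\<gamma>. c * norm \<gamma> \<le> ?W \<gamma>"
    using worst_case_coercive by blast
  \<comment> \<open>outside the ball of radius \<open>R\<close>, coercivity makes every \<open>\<gamma>\<close> worse than \<open>0\<close>\<close>
  define R where "R = ?W 0 / c"
  have zero: "0 \<in> cball 0 R"
    using c(1) c(2)[of 0] by (simp add: R_def)
  then obtain \<gamma> where \<gamma>: "\<And>\<gamma>'. \<gamma>' \<in> cball 0 R \<Longrightarrow> ?W \<gamma> \<le> ?W \<gamma>'"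
    using continuous_attains_inf[OF compact_cball _ continuous_on_worst_case, of 0 R] by blast
  have "?W \<gamma> \<le> ?W \<gamma>'" for \<gamma>'
  proof (cases "\<gamma>' \<in> cball 0 R")
    case False
    then have "?W 0 \<le> c * norm \<gamma>'"
      using c(1) by (simp add: R_def field_simps)
    then show ?thesis using \<gamma>[OF zero] c(2)[of \<gamma>'] by linarith
  qed (rule \<gamma>)
  then show ?thesis by blast
qed

section \<open>The value of the game\<close>

lemma convex_on_payoff: "convex_on (cbox d u) (payoff \<rho> f z \<gamma>)"
proof (rule convex_onI)
  fix t :: real and x y :: "real ^ 3"
  assume t: "0 < t" "t < 1" and xy: "x \<in> cbox d u" "y \<in> cbox d u"
  have eq: "((1 - t) *\<^sub>R x + t *\<^sub>R y) * z = (1 - t) *\<^sub>R (x * z) + t *\<^sub>R (y * z)"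
    by (simp add: vec_eq_iff algebra_simps)
  have "f (((1 - t) *\<^sub>R x + t *\<^sub>R y) * z) \<le> (1 - t) * f (x * z) + t * f (y * z)"
    unfolding eq using t xy by (intro convex_onD[OF f_convex]) (auto intro: prices_in_orthant)
  then show "payoff \<rho> f z \<gamma> ((1 - t) *\<^sub>R x + t *\<^sub>R y)
      \<le> (1 - t) * payoff \<rho> f z \<gamma> x + t * payoff \<rho> f z \<gamma> y"
    unfolding payoff_def eq by (simp add: inner_add_right inner_diff_right algebra_simps)
qed (rule convex_box)

text \<open>
  The right-hand side is the value at \<open>(\<rho>, \<rho>, \<rho>)\<close> of the affine function that agrees with \<open>f\<close> at the
  vertex \<open>q\<close> and its three neighbours. It bounds every worst case from below because the hypothesis
  on the weights makes it an average of payoffs; the slope of the affine function attains it because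
  that function dominates \<open>f\<close> on the box.
\<close>

lemma bellman_eq_interpolation:
  assumes pq: "p = d \<and> q = u \<or> p = u \<and> q = d"
    and weights: "(\<Sum>i\<in>UNIV. (q $ i - \<rho>) / (q $ i - p $ i)) \<le> 1"
  shows "bellman d u \<rho> f z =
    (1 - (\<Sum>i\<in>UNIV. (q $ i - \<rho>) / (q $ i - p $ i))) * vertex_value p q f {} z
    + (\<Sum>i\<in>UNIV. (q $ i - \<rho>) / (q $ i - p $ i) * vertex_value p q f {i} z)"
proof -
  define w where "w i = (q $ i - \<rho>) / (q $ i - p $ i)" for i
  define F where "F I = vertex_value p q f I z" for I
  define vertex :: "3 set \<Rightarrow> real ^ 3" where "vertex I = (\<chi> i. if i \<in> I then p $ i else q $ i)" for I
  define v where "v = (1 - sum w UNIV) * F {} + (\<Sum>i\<in>UNIV. w i * F {i})"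
  have pq_neq: "q $ i - p $ i \<noteq> 0" for i
    using pq d_less_u[of i] by auto
  have w_eq: "w i * (q $ i - p $ i) = q $ i - \<rho>" for i
    using pq_neq[of i] by (simp add: w_def)
  have w_nonneg: "0 \<le> w i" for i
    using pq d_less[of i] less_u[of i] by (auto simp: w_def divide_simps)
  have w0: "0 \<le> 1 - sum w UNIV"
    using weights by (simp add: w_def)
  have vertex_box: "vertex I \<in> cbox d u" for I
    using pq d_less_u by (auto simp: vertex_def mem_box_cart intro: less_imp_le)
  have F_vertex: "F I = f (vertex I * z)" for I
    by (simp add: F_def vertex_def vertex_value_def)
  have payoff_vertex: "payoff \<rho> f z \<gamma> (vertex I)
      = F I - (\<Sum>i\<in>UNIV. \<gamma> $ i * z $ i * (q $ i - \<rho>)) + (\<Sum>i\<in>I. \<gamma> $ i * z $ i * (q $ i - p $ i))"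
    for \<gamma> I
  proof -
    have "(\<Sum>i\<in>I. \<gamma> $ i * z $ i * (q $ i - p $ i))
        = (\<Sum>i\<in>UNIV. if i \<in> I then \<gamma> $ i * z $ i * (q $ i - p $ i) else 0)"
      by (simp add: sum.If_cases)
    moreover have "\<gamma> \<bullet> (vertex I * z - \<rho> *\<^sub>R z) = (\<Sum>i\<in>UNIV. \<gamma> $ i * z $ i * (q $ i - \<rho>)
        - (if i \<in> I then \<gamma> $ i * z $ i * (q $ i - p $ i) else 0))"
      unfolding inner_vec_def by (rule sum.cong) (auto simp: vertex_def algebra_simps)
    ultimately show ?thesis
      by (simp add: payoff_def F_vertex sum_subtractf)
  qed
  have lower: "v \<le> worst_case d u \<rho> f z \<gamma>" for \<gamma>
  proof -
    let ?W = "worst_case d u \<rho> f z \<gamma>"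
    have vle: "payoff \<rho> f z \<gamma> (vertex I) \<le> ?W" for I
      by (rule payoff_le_worst_case[OF vertex_box])
    \<comment> \<open>\<open>A\<close> is the linear term at the base vertex and \<open>B i\<close> its decrease on the way to the
      \<open>i\<close>-th neighbour; the next equation says that the linear term has mean zero under the weights\<close>
    define A where "A = (\<Sum>i\<in>UNIV. \<gamma> $ i * z $ i * (q $ i - \<rho>))"
    define B where "B i = \<gamma> $ i * z $ i * (q $ i - p $ i)" for i
    have A: "A = (\<Sum>i\<in>UNIV. w i * B i)"
      unfolding A_def B_def w_eq[symmetric] by (simp add: mult_ac)
    have "v = (1 - sum w UNIV) * payoff \<rho> f z \<gamma> (vertex {})
        + (\<Sum>i\<in>UNIV. w i * payoff \<rho> f z \<gamma> (vertex {i}))"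
      unfolding payoff_vertex A_def[symmetric] B_def[symmetric] v_def
      by (simp add: distrib_left right_diff_distrib sum.distrib sum_subtractf
          A[symmetric] sum_distrib_right[symmetric]) (simp add: algebra_simps)
    also have "\<dots> \<le> (1 - sum w UNIV) * ?W + (\<Sum>i\<in>UNIV. w i * ?W)"
      using w0 w_nonneg vle by (intro add_mono mult_left_mono sum_mono)
    also have "\<dots> = ?W"
      by (simp add: sum_distrib_right[symmetric] algebra_simps)
    finally show ?thesis .
  qed
  \<comment> \<open>the slope of the affine interpolant in the variables \<open>\<xi> * z\<close>\<close>
  define \<gamma> :: "real ^ 3" where "\<gamma> = (\<chi> i. (F {} - F {i}) / (z $ i * (q $ i - p $ i)))"
  have \<gamma>: "\<gamma> $ i * z $ i * (q $ i - p $ i) = F {} - F {i}" for i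
    using z_pos[of i] pq_neq[of i] by (simp add: \<gamma>_def field_simps)
  have slope: "\<gamma> $ i * z $ i * (q $ i - \<rho>) = w i * (F {} - F {i})" for i
    unfolding \<gamma>[symmetric] w_eq[symmetric] by (simp add: mult_ac)
  have upper: "worst_case d u \<rho> f z \<gamma> \<le> v"
  proof (rule worst_case_le, rule convex_on_cbox_vertex_bound[OF convex_on_payoff _ d_less_u])
    fix x :: "real ^ 3"
    assume x: "\<And>i. x $ i = d $ i \<or> x $ i = u $ i"
    define I where "I = {i. x $ i = p $ i}"
    have "x $ i = vertex I $ i" for i
      using x[of i] pq by (auto simp: vertex_def I_def)
    then have xI: "x = vertex I"
      by (simp add: vec_eq_iff)
    have "F I \<le> F {} + (\<Sum>i\<in>I. F {i} - F {})"
      unfolding F_def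
    proof (rule vertex_value_le_marginals[OF f_submodular])
      show "0 \<le> z $ k" for k using z_pos[of k] by simp
      have "0 \<le> d $ k" "0 \<le> u $ k" for k using d_pos[of k] d_less_u[of k] by auto
      then show "0 \<le> p $ k" "0 \<le> q $ k" for k using pq by auto
      show "(\<forall>k. p $ k \<le> q $ k) \<or> (\<forall>k. q $ k \<le> p $ k)"
        using pq d_less_u by (auto intro: less_imp_le)
    qed
    then have "payoff \<rho> f z \<gamma> x \<le> F {} - (\<Sum>i\<in>UNIV. w i * (F {} - F {i}))"
      unfolding xI payoff_vertex \<gamma> slope by (simp add: sum_subtractf)
    also have "\<dots> = v"
      by (simp add: v_def right_diff_distrib sum_subtractf sum_distrib_right[symmetric])
        (simp add: algebra_simps)
    finally show "payoff \<rho> f z \<gamma> x \<le> v" .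
  qed
  have "bellman d u \<rho> f z = v"
    unfolding bellman_def
    by (rule cInf_eq_minimum) (use lower upper in \<open>auto intro!: image_eqI[of _ _ \<gamma>] antisym\<close>)
  then show ?thesis by (simp add: v_def w_def F_def)
qed

end

theorem theorem7p2:
  fixes d u z :: "real ^ 3" and \<rho> :: real and f :: "real ^ 3 \<Rightarrow> real"
  assumes "\<And>i. 0 < d $ i" and "\<And>i. d $ i < \<rho>" and "\<And>i. \<rho> < u $ i"
    and "\<And>x. x \<in> orthant \<Longrightarrow> 0 \<le> f x"
    and "continuous_on orthant f"
    and "convex_on orthant f"
    and "submodular f"
    and "\<And>i. 0 < z $ i"
  shows
    "(\<forall>\<gamma>. \<exists>\<xi>\<in>cbox d u. \<forall>\<xi>'\<in>cbox d u. payoff \<rho> f z \<gamma> \<xi>' \<le> payoff \<rho> f z \<gamma> \<xi>) \<and>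
     (\<exists>\<gamma>. \<forall>\<gamma>'. worst_case d u \<rho> f z \<gamma> \<le> worst_case d u \<rho> f z \<gamma>') \<and>
     (alpha123 d u \<rho> \<ge> 0 \<longrightarrow>
        bellman d u \<rho> f z =
          alpha123 d u \<rho> * vertex_value d u f {} z
          + (u $ 1 - \<rho>) / (u $ 1 - d $ 1) * vertex_value d u f {1} z
          + (u $ 2 - \<rho>) / (u $ 2 - d $ 2) * vertex_value d u f {2} z
          + (u $ 3 - \<rho>) / (u $ 3 - d $ 3) * vertex_value d u f {3} z) \<and>
     (alpha123 d u \<rho> \<le> -1 \<longrightarrow>
        bellman d u \<rho> f z =
          - (alpha123 d u \<rho> + 1) * vertex_value d u f {1, 2, 3} z
          + (\<rho> - d $ 1) / (u $ 1 - d $ 1) * vertex_value d u f {2, 3} z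
          + (\<rho> - d $ 2) / (u $ 2 - d $ 2) * vertex_value d u f {1, 3} z
          + (\<rho> - d $ 3) / (u $ 3 - d $ 3) * vertex_value d u f {1, 2} z)"
proof -
  interpret robust_hedging d u z \<rho> f
    using assms by unfold_locales
  have gap: "u $ i - d $ i \<noteq> 0" for i
    using d_less_u[of i] by simp
  have compl: "(\<rho> - d $ i) / (u $ i - d $ i) = 1 - (u $ i - \<rho>) / (u $ i - d $ i)" for i
    using gap[of i] by (simp add: field_simps)
  have flip: "(d $ i - \<rho>) / (d $ i - u $ i) = (\<rho> - d $ i) / (u $ i - d $ i)" for i
    by (metis minus_diff_eq minus_divide_divide)
  have case_i: "bellman d u \<rho> f z =
          alpha123 d u \<rho> * vertex_value d u f {} z
          + (u $ 1 - \<rho>) / (u $ 1 - d $ 1) * vertex_value d u f {1} z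
          + (u $ 2 - \<rho>) / (u $ 2 - d $ 2) * vertex_value d u f {2} z
          + (u $ 3 - \<rho>) / (u $ 3 - d $ 3) * vertex_value d u f {3} z"
    if "alpha123 d u \<rho> \<ge> 0"
  proof -
    have "1 - (\<Sum>i\<in>UNIV. (u $ i - \<rho>) / (u $ i - d $ i)) = alpha123 d u \<rho>"
      by (simp add: sum_3 alpha123_def)
    with that show ?thesis
      using bellman_eq_interpolation[of d u] by (simp add: sum_3)
  qed
  have case_ii: "bellman d u \<rho> f z =
          - (alpha123 d u \<rho> + 1) * vertex_value d u f {1, 2, 3} z
          + (\<rho> - d $ 1) / (u $ 1 - d $ 1) * vertex_value d u f {2, 3} z
          + (\<rho> - d $ 2) / (u $ 2 - d $ 2) * vertex_value d u f {1, 3} z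
          + (\<rho> - d $ 3) / (u $ 3 - d $ 3) * vertex_value d u f {1, 2} z"
    if "alpha123 d u \<rho> \<le> -1"
  proof -
    have total: "1 - (\<Sum>i\<in>UNIV. (\<rho> - d $ i) / (u $ i - d $ i)) = - (alpha123 d u \<rho> + 1)"
      unfolding compl by (simp add: sum_3 alpha123_def)
    have compl_sets: "- {1, 2, 3} = ({} :: 3 set)" "- {2, 3} = {1 :: 3}" "- {1, 3} = {2 :: 3}"
      "- {1, 2} = {3 :: 3}"
      using UNIV_3 by auto
    show ?thesis
      using bellman_eq_interpolation[of u d] that total
      unfolding flip vertex_value_swap[of d u] compl_sets by (simp add: sum_3)
  qed
  show ?thesis
    using payoff_attains_max worst_case_attains_min case_i case_ii by blast
qed

end
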